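(* Let $V(i,\beta)$, for $0\le i\le N$ and $\beta\in \mathbf U^i$, be a real-valued solution of the dynamic programming equations $$V(i,\beta)=\min_{\xi\in \mathbf U}\{V(i+1,\beta\otimes\xi)+\Phi(i,x(i;i,\beta),\xi)\}\ \ (0\le i\le N-1,\ \beta\in \mathbf U^i),\qquad V(N,\beta)=\Phi_0(x(N;N,\beta))\ \ (\beta\in \mathbf U^N)$$ (the minima being assumed to exist). Then: (a) $V(i,\beta)=\min_{u_{<i>}\in \mathbf U^{N-i}}J_{i,\beta}(u_{<i>})$ for all $0\le i\le N$ and $\beta\in \mathbf U^i$. (b) If a control $u^*\in \mathbf U^N$ satisfies $V(i,\tilde u^*_{(i)})=J_{i,\tilde u^*_{(i)}}(u^*_{<i>})$ for all $i\in\{0,1,\dots,N\}$, then $u^*$ is an optimal control, i.e. $J(u^* )\le J(u)$ for every admissible control $u\in \mathbf U^N$.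
   Context: Let $N\ge 1$ be an integer, $\mathbf U\subseteq\mathbb R^m$ a compact set of control values, $x_0(i)\in\mathbb R^n$ for $0\le i\le N$, $\varphi(i,j,x,u)\in\mathbb R^n$ for $0\le j<i\le N$, $x\in\mathbb R^n$, $u\in \mathbf U$, and let $\Phi(i,x,u)\in\mathbb R$ ($0\le i\le N-1$) and $\Phi_0(x)\in\mathbb R$ be given functions. An admissible control is a sequence $u=(u(0),\dots,u(N-1))\in \mathbf U^N$. The controlled discrete Volterra equation is $$x(k)=x_0(k)+\sum_{j=0}^{k-1}\varphi(k,j,x(j),u(j)),\qquad 0\le k\le N,$$ (so $x(0)=x_0(0)$), and the cost is $J(u)=\sum_{i=0}^{N-1}\Phi(i,x(i),u(i))+\Phi_0(x(N))$, where $x$ is the solution for $u$. For $\beta=(\beta(0),\dots,\beta(i-1))\in \mathbf U^i$, $x(k;i,\beta)$, $0\le k\le i$, denotes the solution of this equation for $0\le k\le i$ with $u(j)=\beta(j)$, $0\le j\le i-1$. For $i=0$, $\beta$ is the empty sequence $\emptyset$. The concatenation of $\beta=(\beta(j):0\le j\le i-1)$ and $\gamma=(\gamma(j): i\le j\le N-1)$ is the sequence $\beta\otimes\gamma$ equal to $\beta(j)$ for $j\le i-1$ and to $\gamma(j)$ for $j\ge i$. For $\xi\in \mathbf U$, $\beta\otimes\xi=(\beta(0),\dots,\beta(i-1),\xi)\in \mathbf U^{i+1}$. For a control $u$, write $\tilde u_{(i)}=(u(j):0\le j\le i-1)\in \mathbf U^i$ and $u_{<i>}=(u(j): i\le j\le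 N-1)\in \mathbf U^{N-i}$ (empty for $i=0$, resp. $i=N$). For $\beta\in \mathbf U^i$ the parametrized cost is $$J_{i,\beta}(u_{<i>})=\sum_{j=i}^{N-1}\Phi(j,x(j),u(j))+\Phi_0(x(N)),$$ where $x(\cdot)$ is the solution of the discrete Volterra equation for the control $\beta\otimes u_{<i>}$. *)

theory Defs
  imports "HOL-Analysis.Analysis" "HOL-Library.NList"
begin

text \<open>
  A control sequence in the k-fold power of \<open>U\<close> is a list in \<open>nlists k U\<close>. A tail
  (u(i), ..., u(N-1)) is the list of length \<open>N - i\<close> whose entry at position \<open>j\<close> is u(i+j), so
  that concatenation of sequences is \<open>@\<close>, and the initial part and the tail of \<open>u\<close> are
  \<open>take i u\<close> and \<open>drop i u\<close>.
\<close>

text \<open>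
  The solution of the discrete Volterra equation. The right-hand side at time \<open>k\<close> uses only
  earlier states, so the equation itself is a recursive definition. The value at \<open>k\<close> is
  meaningful for \<open>k \<le> length u\<close> only; for a sequence \<open>\<beta>\<close> of length \<open>i\<close> and \<open>k \<le> i\<close>,
  \<open>volterra x0 \<phi> \<beta> k\<close> is the state x(k; i, \<open>\<beta>\<close>).
\<close>

function volterra ::
  "(nat \<Rightarrow> real ^ 'n) \<Rightarrow> (nat \<Rightarrow> nat \<Rightarrow> real ^ 'n \<Rightarrow> real ^ 'm \<Rightarrow> real ^ 'n)
    \<Rightarrow> (real ^ 'm) list \<Rightarrow> nat \<Rightarrow> real ^ 'n"
  where "volterra x0 \<phi> u k = x0 k + (\<Sum>j<k. \<phi> k j (volterra x0 \<phi> u j) (u ! j))"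
  by auto
termination
  by (relation "Wellfounded.measure (\<lambda>(x0, \<phi>, u, k). k)") auto

declare volterra.simps [simp del]

lemma volterra_unique:
  assumes "\<And>k. k \<le> N \<Longrightarrow> x k = x0 k + (\<Sum>j<k. \<phi> k j (x j) (u ! j))" and "k \<le> N"
  shows "x k = volterra x0 \<phi> u k"
  using \<open>k \<le> N\<close>
proof (induction k rule: less_induct)
  case (less k)
  have "(\<Sum>j<k. \<phi> k j (x j) (u ! j)) = (\<Sum>j<k. \<phi> k j (volterra x0 \<phi> u j) (u ! j))"
    using less by (intro sum.cong) auto
  then show ?case
    using assms(1)[OF less.prems] by (simp add: volterra.simps[of x0 \<phi> u k])
qed

definition cost ::
  "nat \<Rightarrow> (nat \<Rightarrow> real ^ 'n) \<Rightarrow> (nat \<Rightarrow> nat \<Rightarrow> real ^ 'n \<Rightarrow> real ^ 'm \<Rightarrow> real ^ 'n)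
    \<Rightarrow> (nat \<Rightarrow> real ^ 'n \<Rightarrow> real ^ 'm \<Rightarrow> real) \<Rightarrow> (real ^ 'n \<Rightarrow> real)
    \<Rightarrow> (real ^ 'm) list \<Rightarrow> real"
  where "cost N x0 \<phi> \<Phi> \<Phi>0 u =
    (\<Sum>i<N. \<Phi> i (volterra x0 \<phi> u i) (u ! i)) + \<Phi>0 (volterra x0 \<phi> u N)"

definition param_cost ::
  "nat \<Rightarrow> (nat \<Rightarrow> real ^ 'n) \<Rightarrow> (nat \<Rightarrow> nat \<Rightarrow> real ^ 'n \<Rightarrow> real ^ 'm \<Rightarrow> real ^ 'n)
    \<Rightarrow> (nat \<Rightarrow> real ^ 'n \<Rightarrow> real ^ 'm \<Rightarrow> real) \<Rightarrow> (real ^ 'n \<Rightarrow> real)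
    \<Rightarrow> nat \<Rightarrow> (real ^ 'm) list \<Rightarrow> (real ^ 'm) list \<Rightarrow> real"
  where "param_cost N x0 \<phi> \<Phi> \<Phi>0 i \<beta> \<gamma> =
    (\<Sum>j = i..<N. \<Phi> j (volterra x0 \<phi> (\<beta> @ \<gamma>) j) ((\<beta> @ \<gamma>) ! j)) + \<Phi>0 (volterra x0 \<phi> (\<beta> @ \<gamma>) N)"

text \<open>
  "The minimum of \<open>f\<close> over \<open>A\<close> exists and equals \<open>v\<close>"; \<open>Min\<close> would require \<open>A\<close> to be finite,
  and \<open>Inf\<close> would not require attainment.
\<close>

definition is_min_on :: "real \<Rightarrow> ('a \<Rightarrow> real) \<Rightarrow> 'a set \<Rightarrow> bool"
  where "is_min_on v f A \<longleftrightarrow> (\<exists>a\<in>A. f a = v) \<and> (\<forall>a\<in>A. v \<le> f a)"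

definition optimal_control ::
  "nat \<Rightarrow> (real ^ 'm) set \<Rightarrow> (nat \<Rightarrow> real ^ 'n)
    \<Rightarrow> (nat \<Rightarrow> nat \<Rightarrow> real ^ 'n \<Rightarrow> real ^ 'm \<Rightarrow> real ^ 'n)
    \<Rightarrow> (nat \<Rightarrow> real ^ 'n \<Rightarrow> real ^ 'm \<Rightarrow> real) \<Rightarrow> (real ^ 'n \<Rightarrow> real)
    \<Rightarrow> (real ^ 'm) list \<Rightarrow> bool"
  where "optimal_control N U x0 \<phi> \<Phi> \<Phi>0 u \<longleftrightarrow>
    u \<in> nlists N U \<and> (\<forall>v\<in>nlists N U. cost N x0 \<phi> \<Phi> \<Phi>0 u \<le> cost N x0 \<phi> \<Phi> \<Phi>0 v)"

end

(*
  Splitting off the first control of a tail turns the parametrized cost into the stage cost plus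
  the parametrized cost from the next time on, because the state at time i depends only on the
  controls before time i. Minimizing first over the rest of the tail and then over its first entry
  gives (a) by backward induction on i. The cost is
  J_0 on full controls, so (b) follows by comparing (a) with the condition on u* at i = 0.
*)

theory Submission
  imports Defs
begin

text \<open>Causality: the right-hand side at time \<open>k\<close> reads states and controls only
  at indices \<open>j < k\<close>, all inside \<open>\<beta>\<close>. This allows even
  \<open>k = length \<beta>\<close>, the state at which the next control is chosen.\<close>

lemma volterra_append:
  "k \<le> length \<beta> \<Longrightarrow> volterra x0 \<phi> (\<beta> @ \<gamma>) k = volterra x0 \<phi> \<beta> k"
proof (induction k rule: less_induct)
  case (less k)
  have "(\<Sum>j<k. \<phi> k j (volterra x0 \<phi> (\<beta> @ \<gamma>) j) ((\<beta> @ \<gamma>) ! j))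
      = (\<Sum>j<k. \<phi> k j (volterra x0 \<phi> \<beta> j) (\<beta> ! j))"
    using less by (intro sum.cong) (auto simp: nth_append)
  then show ?case
    by (simp add: volterra.simps[of x0 \<phi> _ k])
qed

text \<open>Both costs run along the same full control, only bracketed differently, so their sums
  differ by the term \<open>j = i\<close>. Causality lets its state be computed from
  \<open>\<beta>\<close> alone.\<close>

lemma param_cost_Cons:
  assumes "length \<beta> = i" "i < N"
  shows "param_cost N x0 \<phi> \<Phi> \<Phi>0 i \<beta> (\<xi> # \<gamma>) =
    param_cost N x0 \<phi> \<Phi> \<Phi>0 (Suc i) (\<beta> @ [\<xi>]) \<gamma> + \<Phi> i (volterra x0 \<phi> \<beta> i) \<xi>"
  using assms by (auto simp: param_cost_def sum.atLeast_Suc_lessThan volterra_append)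

text \<open>An equality of functions, so that it can rewrite the objective inside
  \<open>is_min_on\<close>.\<close>

lemma param_cost_0: "param_cost N x0 \<phi> \<Phi> \<Phi>0 0 [] = cost N x0 \<phi> \<Phi> \<Phi>0"
  by (simp add: fun_eq_iff param_cost_def cost_def atLeast0LessThan)

text \<open>A minimum over nonempty lists is an iterated minimum: \<open>c \<xi>\<close> does not
  depend on the tail, so it merely shifts the inner minimum. An outer minimizer followed by an inner
  one for that head attains \<open>v\<close>.\<close>

lemma is_min_on_nlists_Suc:
  assumes outer: "is_min_on v (\<lambda>\<xi>. w \<xi> + c \<xi>) U"
    and inner: "\<And>\<xi>. \<xi> \<in> U \<Longrightarrow> is_min_on (w \<xi>) (F \<xi>) (nlists n U)"
    and G: "\<And>\<xi> \<gamma>. G (\<xi> # \<gamma>) = F \<xi> \<gamma> + c \<xi>"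
  shows "is_min_on v G (nlists (Suc n) U)"
  unfolding is_min_on_def
proof (intro conjI ballI)
  obtain \<xi> where \<xi>: "\<xi> \<in> U" "w \<xi> + c \<xi> = v"
    using outer by (auto simp: is_min_on_def)
  obtain \<gamma> where "\<gamma> \<in> nlists n U" "F \<xi> \<gamma> = w \<xi>"
    using inner[OF \<xi>(1)] by (auto simp: is_min_on_def)
  then show "\<exists>\<delta>\<in>nlists (Suc n) U. G \<delta> = v"
    using \<xi> G by (intro bexI[of _ "\<xi> # \<gamma>"]) auto
next
  fix \<delta> assume "\<delta> \<in> nlists (Suc n) U"
  then obtain \<xi> \<gamma> where \<delta>: "\<delta> = \<xi> # \<gamma>" "\<xi> \<in> U" "\<gamma> \<in> nlists n U"
    by (auto simp: in_nlists_Suc_iff)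
  have "v \<le> w \<xi> + c \<xi>"
    using outer \<delta>(2) by (auto simp: is_min_on_def)
  also have "\<dots> \<le> F \<xi> \<gamma> + c \<xi>"
    using inner[OF \<delta>(2)] \<delta>(3) by (auto simp: is_min_on_def)
  finally show "v \<le> G \<delta>"
    by (simp add: \<delta>(1) G)
qed

theorem theorem2p2:
  fixes N :: nat
    and U :: "(real ^ 'm) set"
    and x0 :: "nat \<Rightarrow> real ^ 'n"
    and \<phi> :: "nat \<Rightarrow> nat \<Rightarrow> real ^ 'n \<Rightarrow> real ^ 'm \<Rightarrow> real ^ 'n"
    and \<Phi> :: "nat \<Rightarrow> real ^ 'n \<Rightarrow> real ^ 'm \<Rightarrow> real"
    and \<Phi>0 :: "real ^ 'n \<Rightarrow> real"
    and V :: "nat \<Rightarrow> (real ^ 'm) list \<Rightarrow> real"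
  assumes "N \<ge> 1"
    and "compact U"
    and "\<And>i \<beta>. i < N \<Longrightarrow> \<beta> \<in> nlists i U \<Longrightarrow>
      is_min_on (V i \<beta>) (\<lambda>\<xi>. V (i + 1) (\<beta> @ [\<xi>]) + \<Phi> i (volterra x0 \<phi> \<beta> i) \<xi>) U"
    and "\<And>\<beta>. \<beta> \<in> nlists N U \<Longrightarrow> V N \<beta> = \<Phi>0 (volterra x0 \<phi> \<beta> N)"
  shows "(\<forall>i\<le>N. \<forall>\<beta>\<in>nlists i U.
            is_min_on (V i \<beta>) (param_cost N x0 \<phi> \<Phi> \<Phi>0 i \<beta>) (nlists (N - i) U)) \<and>
         (\<forall>u\<in>nlists N U.
            (\<forall>i\<le>N. V i (take i u) = param_cost N x0 \<phi> \<Phi> \<Phi>0 i (take i u) (drop i u)) \<longrightarrow>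
            optimal_control N U x0 \<phi> \<Phi> \<Phi>0 u)"
proof -
  \<comment> \<open>The quantifier over \<open>\<beta>\<close> stays inside the induction, since the
    step at \<open>i\<close> uses the claim at every extension
    \<open>\<beta> @ [\<xi>]\<close>.\<close>
  have a: "\<forall>\<beta>\<in>nlists i U. is_min_on (V i \<beta>) (param_cost N x0 \<phi> \<Phi> \<Phi>0 i \<beta>) (nlists (N - i) U)"
    if "i \<le> N" for i
    using that
  proof (induction i rule: inc_induct)
    case base
    \<comment> \<open>At \<open>i = N\<close> the only tail is \<open>[]\<close> and the running sum
      is empty, which leaves the terminal cost.\<close>
    show ?case
      using assms(4) by (auto simp: is_min_on_def param_cost_def)
  next
    case (step i)
    note i = step.hyps(2)
    show ?case
    proof
      fix \<beta> assume \<beta>: "\<beta> \<in> nlists i U"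
      have outer: "is_min_on (V i \<beta>)
          (\<lambda>\<xi>. V (Suc i) (\<beta> @ [\<xi>]) + \<Phi> i (volterra x0 \<phi> \<beta> i) \<xi>) U"
        using assms(3)[OF i \<beta>] unfolding Suc_eq_plus1 .
      have inner: "is_min_on (V (Suc i) (\<beta> @ [\<xi>]))
          (param_cost N x0 \<phi> \<Phi> \<Phi>0 (Suc i) (\<beta> @ [\<xi>])) (nlists (N - Suc i) U)"
        if "\<xi> \<in> U" for \<xi>
      proof -
        have "\<beta> @ [\<xi>] \<in> nlists (Suc i) U"
          using nlists_appendI[OF \<beta>, of "[\<xi>]" 1] that by simp
        with step.IH show ?thesis
          by (rule bspec)
      qed
      have "param_cost N x0 \<phi> \<Phi> \<Phi>0 i \<beta> (\<xi> # \<gamma>) =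
          param_cost N x0 \<phi> \<Phi> \<Phi>0 (Suc i) (\<beta> @ [\<xi>]) \<gamma> + \<Phi> i (volterra x0 \<phi> \<beta> i) \<xi>" for \<xi> \<gamma>
        using nlistsE_length[OF \<beta>] i by (rule param_cost_Cons)
      with outer inner
      \<comment> \<open>As \<open>i < N\<close>, the length \<open>Suc (N - Suc i)\<close> equals
        \<open>N - i\<close>; this form exhibits the first control of the tail.\<close>
      have "is_min_on (V i \<beta>) (param_cost N x0 \<phi> \<Phi> \<Phi>0 i \<beta>) (nlists (Suc (N - Suc i)) U)"
        by (rule is_min_on_nlists_Suc[where w = "\<lambda>\<xi>. V (Suc i) (\<beta> @ [\<xi>])"
            and c = "\<lambda>\<xi>. \<Phi> i (volterra x0 \<phi> \<beta> i) \<xi>"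
            and F = "\<lambda>\<xi>. param_cost N x0 \<phi> \<Phi> \<Phi>0 (Suc i) (\<beta> @ [\<xi>])"])
      then show "is_min_on (V i \<beta>) (param_cost N x0 \<phi> \<Phi> \<Phi>0 i \<beta>) (nlists (N - i) U)"
        using i by (simp add: Suc_diff_Suc)
    qed
  qed
  have "is_min_on (V 0 []) (cost N x0 \<phi> \<Phi> \<Phi>0) (nlists N U)"
    using a[of 0] by (simp add: param_cost_0)
  then have "optimal_control N U x0 \<phi> \<Phi> \<Phi>0 u"
    if "u \<in> nlists N U"
      "\<forall>i\<le>N. V i (take i u) = param_cost N x0 \<phi> \<Phi> \<Phi>0 i (take i u) (drop i u)" for u
    \<comment> \<open>At \<open>i = 0\<close> the prefix is empty and the tail is \<open>u\<close>
      itself, so the condition says that the cost of \<open>u\<close> is the minimum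
      \<open>V 0 []\<close>.\<close>
    using that(1) that(2)[rule_format, of 0]
    by (simp add: optimal_control_def is_min_on_def param_cost_0)
  with a show ?thesis
    by simp
qed

end
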